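(* Let $(X,d)$ be an infinite ultrametric space. Then the following statements are equivalent: (i) There exists an ultrametric space $(Y,\rho)\in \mathbf{US}$ such that $(X,d)$ is isometric to a subspace of $(Y,\rho)$. (ii) $(X,d)$ contains no four-point subspace whose diametrical graph is isomorphic to the cycle $C_4$. (iii) $(X,d)$ contains no four-point subspace which is weakly similar to $(X_4,d_4)$ or to $(Y_4,\rho_4)$.
   Context: An ultrametric space is a metric space $(X,d)$ with $d(x,y)\le\max\{d(x,z),d(z,y)\}$ for all $x,y,z\in X$. Subspaces carry the restricted metric. A star graph $S$ is a tree (possibly infinite) having a vertex $c$, its center, adjacent to every other vertex, with no other edges. A labeled star graph $S(l)$ is a star graph $S$ with a function $l\colon V(S)\to[0,\infty)$. Define $d_l(u,v)=0$ if $u=v$ and $d_l(u,v)=\max_{w\in V(P)} l(w)$ otherwise, where $P$ is the unique path joining $u$ and $v$ in $S$ (endpoints included). The class $\mathbf{US}$ consists of all ultrametric spaces $(X,d)$ for which there is a labeled star graph $S(l)$ with $X=V(S)$ and $d=d_l$. Diametrical graph: for a metric space $(X,d)$, $G_{X,d}$ is the graph with vertex set $X$ in which $u,v$ are adjacent iff $u\ne v$ and $d(u,v)=\operatorname{diam}X$. $C_4$ is the cycle with four vertices. Weak similarity: with $D(X)=\{d(x,y):x,y\in X\}$, a bijection $\Phi\colon X\to Y$ between metric spaces $(X,d)$ and $(Y,\delta)$ is a weak similarity if there is a strictly increasing bijection $f\colon D(Y)\to D(X)$ with $d(x,y)=f(\delta(\Phi(x),\Phi(y)))$ for all $x,y\in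 X$; the spaces are weakly similar if such a $\Phi$ exists. $X_4=\{x_1,x_2,x_3,x_4\}$ has the ultrametric $d_4$ with $d_4(x_1,x_3)=1$, $d_4(x_2,x_4)=2$, and all other distances between distinct points equal to $3$. $Y_4=\{y_1,y_2,y_3,y_4\}$ has the ultrametric $\rho_4$ with $\rho_4(y_1,y_3)=\rho_4(y_2,y_4)=2$, and all other distances between distinct points equal to $3$. *)

theory Defs
  imports "HOL-Analysis.Analysis"
begin

locale Ultrametric_space = Metric_space +
  assumes ultra: "\<And>x y z. \<lbrakk>x \<in> M; y \<in> M; z \<in> M\<rbrakk> \<Longrightarrow> d x y \<le> max (d x z) (d z y)"

definition isometric :: "'a set \<Rightarrow> ('a \<Rightarrow> 'a \<Rightarrow> real) \<Rightarrow> 'b set \<Rightarrow> ('b \<Rightarrow> 'b \<Rightarrow> real) \<Rightarrow> bool" where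
  "isometric X d Y \<rho> \<longleftrightarrow>
     (\<exists>f. bij_betw f X Y \<and> (\<forall>x\<in>X. \<forall>y\<in>X. \<rho> (f x) (f y) = d x y))"

text \<open>Simple undirected graphs, possibly infinite, are given by a vertex set \<open>V\<close> and a set \<open>E\<close>
  of two-element subsets of \<open>V\<close>. (Symmetric digraphs are unsuitable for trees: there the
  closed walk \<open>u, v, u\<close> along a single edge already counts as a cycle.)\<close>

definition simple_graph :: "'a set \<Rightarrow> 'a set set \<Rightarrow> bool" where
  "simple_graph V E \<longleftrightarrow> E \<subseteq> {{u, v} | u v. u \<in> V \<and> v \<in> V \<and> u \<noteq> v}"

definition graph_path :: "'a set \<Rightarrow> 'a set set \<Rightarrow> 'a list \<Rightarrow> bool" where
  "graph_path V E p \<longleftrightarrow> p \<noteq> [] \<and> distinct p \<and> set p \<subseteq> V \<and>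
     (\<forall>i. Suc i < length p \<longrightarrow> {p ! i, p ! Suc i} \<in> E)"

definition joins :: "'a set \<Rightarrow> 'a set set \<Rightarrow> 'a list \<Rightarrow> 'a \<Rightarrow> 'a \<Rightarrow> bool" where
  "joins V E p u v \<longleftrightarrow> graph_path V E p \<and> hd p = u \<and> last p = v"

definition graph_cycle :: "'a set \<Rightarrow> 'a set set \<Rightarrow> 'a list \<Rightarrow> bool" where
  "graph_cycle V E p \<longleftrightarrow> graph_path V E p \<and> 3 \<le> length p \<and> {last p, hd p} \<in> E"

definition tree :: "'a set \<Rightarrow> 'a set set \<Rightarrow> bool" where
  "tree V E \<longleftrightarrow> simple_graph V E \<and> V \<noteq> {} \<and>
     (\<forall>u\<in>V. \<forall>v\<in>V. \<exists>p. joins V E p u v) \<and> (\<nexists>p. graph_cycle V E p)"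

definition star_graph :: "'a set \<Rightarrow> 'a set set \<Rightarrow> 'a \<Rightarrow> bool" where
  "star_graph V E c \<longleftrightarrow> tree V E \<and> c \<in> V \<and> E = {{c, v} | v. v \<in> V \<and> v \<noteq> c}"

text \<open>The distance \<open>d\<^sub>l\<close> is meaningful on trees, where the path joining two vertices is unique.\<close>

definition label_dist :: "'a set \<Rightarrow> 'a set set \<Rightarrow> ('a \<Rightarrow> real) \<Rightarrow> 'a \<Rightarrow> 'a \<Rightarrow> real" where
  "label_dist V E l u v =
     (if u = v then 0 else Max (l ` set (THE p. joins V E p u v)))"

definition in_US :: "'a set \<Rightarrow> ('a \<Rightarrow> 'a \<Rightarrow> real) \<Rightarrow> bool" where
  "in_US X d \<longleftrightarrow> Ultrametric_space X d \<and>
     (\<exists>E c l. star_graph X E c \<and> (\<forall>v\<in>X. 0 \<le> l v) \<and>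
        (\<forall>u\<in>X. \<forall>v\<in>X. d u v = label_dist X E l u v))"

text \<open>HOL has no quantification over types inside a formula, so the type from which the points
  of the space \<open>Y\<close> are drawn is made an explicit parameter.\<close>

definition isometric_to_subspace_of_US ::
  "'b itself \<Rightarrow> 'a set \<Rightarrow> ('a \<Rightarrow> 'a \<Rightarrow> real) \<Rightarrow> bool" where
  "isometric_to_subspace_of_US (_ :: 'b itself) X d \<longleftrightarrow>
     (\<exists>(Y :: 'b set) \<rho>. in_US Y \<rho> \<and> (\<exists>Z. Z \<subseteq> Y \<and> isometric X d Z \<rho>))"

definition graph_isomorphic :: "'a set \<Rightarrow> 'a set set \<Rightarrow> 'b set \<Rightarrow> 'b set set \<Rightarrow> bool" where
  "graph_isomorphic V E W F \<longleftrightarrow>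
     (\<exists>f. bij_betw f V W \<and> (\<forall>u\<in>V. \<forall>v\<in>V. {u, v} \<in> E \<longleftrightarrow> {f u, f v} \<in> F))"

text \<open>The diameter is extended-real valued, as it may be infinite.\<close>

definition diam :: "'a set \<Rightarrow> ('a \<Rightarrow> 'a \<Rightarrow> real) \<Rightarrow> ereal" where
  "diam X d = (SUP (x, y) \<in> X \<times> X. ereal (d x y))"

definition diametrical_edges :: "'a set \<Rightarrow> ('a \<Rightarrow> 'a \<Rightarrow> real) \<Rightarrow> 'a set set" where
  "diametrical_edges X d =
     {{u, v} | u v. u \<in> X \<and> v \<in> X \<and> u \<noteq> v \<and> ereal (d u v) = diam X d}"

definition C4_verts :: "nat set" where
  "C4_verts = {1, 2, 3, 4}"

definition C4_edges :: "nat set set" where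
  "C4_edges = {{1, 2}, {2, 3}, {3, 4}, {4, 1}}"

definition dist_set :: "'a set \<Rightarrow> ('a \<Rightarrow> 'a \<Rightarrow> real) \<Rightarrow> real set" where
  "dist_set X d = {d x y | x y. x \<in> X \<and> y \<in> X}"

definition weakly_similar ::
  "'a set \<Rightarrow> ('a \<Rightarrow> 'a \<Rightarrow> real) \<Rightarrow> 'b set \<Rightarrow> ('b \<Rightarrow> 'b \<Rightarrow> real) \<Rightarrow> bool" where
  "weakly_similar X d Y \<delta> \<longleftrightarrow>
     (\<exists>\<Phi> f. bij_betw \<Phi> X Y \<and>
        bij_betw f (dist_set Y \<delta>) (dist_set X d) \<and> strict_mono_on (dist_set Y \<delta>) f \<and>
        (\<forall>x\<in>X. \<forall>y\<in>X. d x y = f (\<delta> (\<Phi> x) (\<Phi> y))))"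

text \<open>The points \<open>x\<^sub>i\<close> and \<open>y\<^sub>i\<close> are represented by their indices.\<close>

definition X4 :: "nat set" where
  "X4 = {1, 2, 3, 4}"

definition d4 :: "nat \<Rightarrow> nat \<Rightarrow> real" where
  "d4 i j = (if i = j then 0 else if {i, j} = {1, 3} then 1 else if {i, j} = {2, 4} then 2 else 3)"

definition Y4 :: "nat set" where
  "Y4 = {1, 2, 3, 4}"

definition rho4 :: "nat \<Rightarrow> nat \<Rightarrow> real" where
  "rho4 i j = (if i = j then 0 else if {i, j} = {1, 3} \<or> {i, j} = {2, 4} then 2 else 3)"

lemma Ultrametric_space_X4: "Ultrametric_space X4 d4"
proof
  show um: "d4 x y \<le> max (d4 x z) (d4 z y)" if "x \<in> X4" "y \<in> X4" "z \<in> X4" for x y z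
    using that unfolding X4_def
    by (elim insertE emptyE) (simp_all add: d4_def doubleton_eq_iff)
  show nn: "0 \<le> d4 x y" for x y
    by (simp add: d4_def)
  show "d4 x y = d4 y x" for x y
    by (simp add: d4_def insert_commute)
  show "d4 x y = 0 \<longleftrightarrow> x = y" for x y
    by (simp add: d4_def)
  show "d4 x z \<le> d4 x y + d4 y z" if "x \<in> X4" "y \<in> X4" "z \<in> X4" for x y z
    using um[of x z y] nn[of x y] nn[of y z] that by linarith
qed

lemma Ultrametric_space_Y4: "Ultrametric_space Y4 rho4"
proof
  show um: "rho4 x y \<le> max (rho4 x z) (rho4 z y)" if "x \<in> Y4" "y \<in> Y4" "z \<in> Y4" for x y z
    using that unfolding Y4_def
    by (elim insertE emptyE) (simp_all add: rho4_def doubleton_eq_iff)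
  show nn: "0 \<le> rho4 x y" for x y
    by (simp add: rho4_def)
  show "rho4 x y = rho4 y x" for x y
    by (simp add: rho4_def insert_commute)
  show "rho4 x y = 0 \<longleftrightarrow> x = y" for x y
    by (simp add: rho4_def)
  show "rho4 x z \<le> rho4 x y + rho4 y z" if "x \<in> Y4" "y \<in> Y4" "z \<in> Y4" for x y z
    using um[of x z y] nn[of x y] nn[of y z] that by linarith
qed

end

theory Submission
  imports Defs
begin

text \<open>On a labeled star with center \<open>c\<close> the distance of distinct points is
  \<open>d u v = max (m u) (m v)\<close> with \<open>m u = max (l c) (l u)\<close>. Such a distance admits no two pairs
  \<open>p, r\<close> and \<open>q, s\<close> of points whose four cross distances all equal some \<open>D\<close> while \<open>d p r < D\<close> and
  \<open>d q s < D\<close>; such quadruples are exactly the four-point subspaces excluded in (ii) and in (iii).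
  Conversely, let \<open>m x\<close> be the infimum of the distances from \<open>x\<close> to the other points. If
  \<open>max (m x) (m y) < d x y\<close>, then points \<open>x'\<close> and \<open>y'\<close> closer than \<open>d x y\<close> to \<open>x\<close> and \<open>y\<close> complete an
  excluded quadruple; hence \<open>d x y = max (m x) (m y)\<close>. If \<open>m\<close> has a zero, it serves as the center of
  a star; otherwise a new center with label \<open>0\<close> is added, and there is room for it in the same type
  because \<open>X\<close> is infinite.\<close>

section \<open>Star graphs\<close>

lemma star_edge_center:
  assumes "star_graph V E c" "{a, b} \<in> E"
  shows "a = c \<or> b = c"
  using assms by (auto simp: star_graph_def doubleton_eq_iff)

text \<open>A path meets \<open>c\<close> at most once while each of its edges contains
  \<open>c\<close>, so it has at most two edges. Only this property of the edges is assumed, which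
  lets the lemma serve for excluding cycles before the graph is known to be a tree.\<close>

lemma path_cases_if_edges_meet_center:
  assumes p: "graph_path V E p" and c: "\<And>a b. {a, b} \<in> E \<Longrightarrow> a = c \<or> b = c"
  obtains x where "p = [x]" | x y where "p = [x, y]" "x = c \<or> y = c" "x \<noteq> y"
  | x y where "p = [x, c, y]" "x \<noteq> c" "y \<noteq> c" "x \<noteq> y"
proof -
  have d: "distinct p" and ne: "p \<noteq> []"
    using p by (auto simp: graph_path_def)
  have e: "p ! i = c \<or> p ! Suc i = c" if "Suc i < length p" for i
    using p c that by (auto simp: graph_path_def)
  have "length p < 4"
  proof (rule ccontr)
    assume "\<not> length p < 4"
    \<comment> \<open>The first and third edges of a path on four or more vertices are disjoint, yet
      both would contain \<open>c\<close>.\<close>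
    moreover from this have "p ! 0 = c \<or> p ! 1 = c" "p ! 2 = c \<or> p ! 3 = c"
      using e[of 0] e[of 2] by (auto simp: numeral_3_eq_3 numeral_2_eq_2)
    ultimately show False
      using nth_eq_iff_index_eq[OF d, of 0 2] nth_eq_iff_index_eq[OF d, of 0 3]
        nth_eq_iff_index_eq[OF d, of 1 2] nth_eq_iff_index_eq[OF d, of 1 3] ne by auto
  qed
  with ne consider "length p = Suc 0" | "length p = Suc (Suc 0)" | "length p = Suc (Suc (Suc 0))"
    by (cases "length p") (auto simp: numeral_3_eq_3 less_Suc_eq)
  then show thesis
  proof cases
    case 1
    then show thesis using that(1) by (auto simp: length_Suc_conv)
  next
    case 2
    then obtain x y where "p = [x, y]" by (auto simp: length_Suc_conv)
    then show thesis using that(2) e[of 0] d by auto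
  next
    case 3
    then obtain x y z where xyz: "p = [x, y, z]" by (auto simp: length_Suc_conv)
    moreover from this have "y = c" using e[of 0] e[of 1] d by auto
    ultimately show thesis using that(3) d by auto
  qed
qed

text \<open>The equivalence form makes the path in \<open>label_dist\<close> explicit: rewriting
  with it turns the \<open>THE\<close> term into a concrete list.\<close>

lemma star_graph_path:
  assumes s: "star_graph V E c" and u: "u \<in> V" and v: "v \<in> V" and uv: "u \<noteq> v"
  shows "joins V E p u v \<longleftrightarrow> p = (if u = c \<or> v = c then [u, v] else [u, c, v])"
proof
  assume "joins V E p u v"
  then have p: "graph_path V E p" "hd p = u" "last p = v" by (auto simp: joins_def)
  show "p = (if u = c \<or> v = c then [u, v] else [u, c, v])"
    by (rule path_cases_if_edges_meet_center[OF p(1), of c])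
      (use star_edge_center[OF s] p uv in auto)
next
  have "c \<in> V" and E: "E = {{c, w} | w. w \<in> V \<and> w \<noteq> c}" using s by (auto simp: star_graph_def)
  moreover assume "p = (if u = c \<or> v = c then [u, v] else [u, c, v])"
  ultimately show "joins V E p u v"
    using u v uv unfolding joins_def graph_path_def E
    by (auto simp: less_Suc_eq doubleton_eq_iff)
qed

text \<open>The label of the center lies on every path between distinct vertices, so it can be
  absorbed into both arguments; this covers the case where an endpoint is the center.\<close>

lemma label_dist_star:
  assumes "star_graph V E c" "u \<in> V" "v \<in> V" "u \<noteq> v"
  shows "label_dist V E l u v = max (max (l c) (l u)) (max (l c) (l v))"
  using assms(4) unfolding label_dist_def star_graph_path[OF assms] by (auto simp: max_def)

lemma star_graph_exists:
  assumes c: "c \<in> V"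
  shows "star_graph V {{c, v} | v. v \<in> V \<and> v \<noteq> c} c"
proof -
  define E where "E = {{c, v} | v. v \<in> V \<and> v \<noteq> c}"
  have edge: "a = c \<or> b = c" if "{a, b} \<in> E" for a b
    using that by (auto simp: E_def doubleton_eq_iff)
  have "joins V E (if u = v then [u] else if u = c \<or> v = c then [u, v] else [u, c, v]) u v"
    if "u \<in> V" "v \<in> V" for u v
    using that c unfolding joins_def graph_path_def E_def
    by (auto simp: less_Suc_eq doubleton_eq_iff)
  moreover have "\<not> graph_cycle V E p" for p
  proof
    assume "graph_cycle V E p"
    then have p: "graph_path V E p" "3 \<le> length p" "{last p, hd p} \<in> E"
      by (auto simp: graph_cycle_def)
    from p(1) edge show False
      \<comment> \<open>A path with three vertices is \<open>[x, c, y]\<close>, and the edge closing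
        it would miss \<open>c\<close>.\<close>
      by (rule path_cases_if_edges_meet_center) (use p edge[OF p(3)] in auto)
  qed
  moreover have "simple_graph V E"
    using c unfolding simple_graph_def E_def by blast
  ultimately have "tree V E"
    using c unfolding tree_def by blast
  then show ?thesis
    using c by (simp add: star_graph_def E_def)
qed

lemma in_US_imp_max_form:
  assumes "in_US Y \<rho>"
  obtains m where "\<And>u v. u \<in> Y \<Longrightarrow> v \<in> Y \<Longrightarrow> u \<noteq> v \<Longrightarrow> \<rho> u v = max (m u) (m v)"
proof -
  obtain E c l where "star_graph Y E c"
    and "\<And>u v. u \<in> Y \<Longrightarrow> v \<in> Y \<Longrightarrow> \<rho> u v = label_dist Y E l u v"
    using assms unfolding in_US_def by blast
  then show thesis
    by (intro that[of "\<lambda>u. max (l c) (l u)"]) (simp add: label_dist_star)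
qed

text \<open>The function \<open>m\<close> itself is the labeling: as \<open>m c = 0\<close>, the
  center contributes nothing to the maximum along a path.\<close>

lemma max_form_imp_in_US:
  assumes "Ultrametric_space Y \<rho>" and c: "c \<in> Y" "\<And>v. v \<in> Y \<Longrightarrow> 0 \<le> m v" "m c = 0"
    and m: "\<And>u v. u \<in> Y \<Longrightarrow> v \<in> Y \<Longrightarrow> u \<noteq> v \<Longrightarrow> \<rho> u v = max (m u) (m v)"
  shows "in_US Y \<rho>"
proof -
  interpret Ultrametric_space Y \<rho> by fact
  let ?E = "{{c, v} | v. v \<in> Y \<and> v \<noteq> c}"
  have "\<rho> u v = label_dist Y ?E m u v" if uv: "u \<in> Y" "v \<in> Y" for u v
  proof (cases "u = v")
    case False
    then show ?thesis
      using label_dist_star[OF star_graph_exists[OF c(1)] uv False, of m] m[OF uv False] c uv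
      by (simp add: max_def)
  qed (use uv in \<open>simp add: label_dist_def\<close>)
  then show ?thesis
    unfolding in_US_def using assms(1) star_graph_exists[OF c(1)] c(2) by blast
qed

text \<open>The outer \<open>max 0\<close> is there because \<open>Metric_space\<close> demands
  nonnegativity for all arguments, also outside \<open>Y\<close>. Two zeros of \<open>m\<close>
  would be distinct points at distance 0, hence \<open>inj\<close>.\<close>

lemma Ultrametric_space_max_form:
  fixes m :: "'a \<Rightarrow> real"
  assumes nonneg: "\<And>v. v \<in> Y \<Longrightarrow> 0 \<le> m v"
    and inj: "\<And>u v. u \<in> Y \<Longrightarrow> v \<in> Y \<Longrightarrow> m u = 0 \<Longrightarrow> m v = 0 \<Longrightarrow> u = v"
  shows "Ultrametric_space Y (\<lambda>u v. if u = v then 0 else max 0 (max (m u) (m v)))"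
proof
  show "(if x = y then 0 else max 0 (max (m x) (m y))) = 0 \<longleftrightarrow> x = y" if "x \<in> Y" "y \<in> Y" for x y
    using nonneg[OF that(1)] nonneg[OF that(2)] inj[OF that] by (auto simp: max_def)
qed (auto simp: max_def)

section \<open>Crossing quadruples\<close>

text \<open>The points are listed in cyclic order: \<open>p\<close>, \<open>r\<close> and
  \<open>q\<close>, \<open>s\<close> are the diagonals of a 4-cycle whose sides all have length
  \<open>D\<close>.\<close>

definition crossing_quadruple :: "('a \<Rightarrow> 'a \<Rightarrow> real) \<Rightarrow> 'a \<Rightarrow> 'a \<Rightarrow> 'a \<Rightarrow> 'a \<Rightarrow> real \<Rightarrow> bool" where
  "crossing_quadruple d p q r s D \<longleftrightarrow> p \<noteq> r \<and> q \<noteq> s \<and> d p r < D \<and> d q s < D \<and>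
     d p q = D \<and> d q r = D \<and> d r s = D \<and> d s p = D"

text \<open>The side \<open>p q\<close> has length \<open>m p\<close> or \<open>m q\<close>.
  Whichever point attains \<open>D\<close> also forces the diagonal through it to be at least
  \<open>D\<close>.\<close>

lemma no_crossing_quadruple_in_max_form:
  assumes m: "\<And>u v. u \<in> Y \<Longrightarrow> v \<in> Y \<Longrightarrow> u \<noteq> v \<Longrightarrow> \<rho> u v = max (m u) (m v)"
    and "p \<in> Y" "q \<in> Y" "r \<in> Y" "s \<in> Y" "p \<noteq> q"
  shows "\<not> crossing_quadruple \<rho> p q r s D"
  using m[of p q] m[of p r] m[of q s] assms(2-)
  by (auto simp: crossing_quadruple_def max_def split: if_splits)

section \<open>Constructing weak similarities and numbering four points\<close>

lemma dist_set_weak_similarity: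
  assumes "bij_betw \<Phi> X Y" "\<forall>x\<in>X. \<forall>y\<in>X. d x y = f (\<delta> (\<Phi> x) (\<Phi> y))"
  shows "f ` dist_set Y \<delta> = dist_set X d"
proof -
  have Y: "Y = \<Phi> ` X" using assms(1) by (simp add: bij_betw_def)
  have "dist_set Y \<delta> = (\<lambda>(x, y). \<delta> (\<Phi> x) (\<Phi> y)) ` (X \<times> X)"
    unfolding dist_set_def Y by force
  moreover have "dist_set X d = (\<lambda>(x, y). d x y) ` (X \<times> X)"
    unfolding dist_set_def by force
  ultimately show ?thesis
    using assms(2) by (auto simp: image_image intro!: image_cong)
qed

text \<open>Bijectivity of \<open>f\<close> between the distance sets comes for free: injectivity
  from strict monotonicity, surjectivity from the distance equation.\<close>

lemma weakly_similarI:
  assumes "bij_betw \<Phi> X Y" "strict_mono_on (dist_set Y \<delta>) f"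
    "\<And>x y. x \<in> X \<Longrightarrow> y \<in> X \<Longrightarrow> d x y = f (\<delta> (\<Phi> x) (\<Phi> y))"
  shows "weakly_similar X d Y \<delta>"
proof -
  have "bij_betw f (dist_set Y \<delta>) (dist_set X d)"
    unfolding bij_betw_def
    using strict_mono_on_imp_inj_on[OF assms(2)] dist_set_weak_similarity[OF assms(1)] assms(3) by blast
  then show ?thesis
    unfolding weakly_similar_def using assms by blast
qed

lemma bij_betw_onto_four:
  assumes "bij_betw f S {1, 2, 3, 4 :: nat}"
  obtains p q r s where "S = {p, q, r, s}" "f p = 1" "f q = 2" "f r = 3" "f s = 4"
proof
  let ?g = "inv_into S f"
  have img: "?g ` {1, 2, 3, 4} = S"
    using bij_betw_inv_into[OF assms] by (simp add: bij_betw_def)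
  then show "S = {?g 1, ?g 2, ?g 3, ?g 4}" by auto
  have "f (?g i) = i" if "i \<in> {1, 2, 3, 4}" for i
    using bij_betw_inv_into_right[OF assms that] .
  then show "f (?g 1) = 1" "f (?g 2) = 2" "f (?g 3) = 3" "f (?g 4) = 4" by auto
qed

lemma bij_betw_four_onto:
  assumes "distinct [p, q, r, s]"
  obtains f where "bij_betw f {p, q, r, s} {1, 2, 3, 4 :: nat}"
    "f p = 1" "f q = 2" "f r = 3" "f s = 4"
proof
  let ?f = "\<lambda>x. if x = p then 1 else if x = q then 2 else if x = r then 3 else (4 :: nat)"
  show "bij_betw ?f {p, q, r, s} {1, 2, 3, 4}" "?f p = 1" "?f q = 2" "?f r = 3" "?f s = 4"
    using assms by (auto simp: bij_betw_def inj_on_def)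
qed

context Ultrametric_space
begin

lemma crossing_quadruple_distinct:
  assumes "crossing_quadruple d p q r s D" "{p, q, r, s} \<subseteq> M"
  shows "distinct [p, q, r, s]"
proof -
  have "0 < D" using assms nonneg[of p r] by (auto simp: crossing_quadruple_def)
  then show ?thesis using assms by (auto simp: crossing_quadruple_def)
qed

text \<open>Reversing the cycle exchanges the two diagonals, so that either may be taken as the
  shorter one.\<close>

lemma crossing_quadruple_swap:
  assumes "crossing_quadruple d p q r s D"
  shows "crossing_quadruple d q p s r D"
  using assms commute by (auto simp: crossing_quadruple_def)

section \<open>Four-point subspaces with diametrical graph \<open>C_4\<close>\<close>

lemma diametrical_edge_iff:
  "{u, v} \<in> diametrical_edges S d \<longleftrightarrow> u \<in> S \<and> v \<in> S \<and> u \<noteq> v \<and> ereal (d u v) = diam S d"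
  unfolding diametrical_edges_def using commute by (auto simp: doubleton_eq_iff)

lemma dist_le_diam: "u \<in> S \<Longrightarrow> v \<in> S \<Longrightarrow> ereal (d u v) \<le> diam S d"
  unfolding diam_def by (rule SUP_upper2[of "(u, v)"]) auto

lemma crossing_quadruple_diam:
  assumes "crossing_quadruple d p q r s D" "{p, q, r, s} \<subseteq> M"
  shows "diam {p, q, r, s} d = ereal D"
proof (rule antisym)
  have "0 \<le> D" using assms nonneg[of p q] by (auto simp: crossing_quadruple_def)
  then have "d u v \<le> D" if "u \<in> {p, q, r, s}" "v \<in> {p, q, r, s}" for u v
    using assms that commute[of r p] commute[of s q] commute[of q p] commute[of r q]
      commute[of s r] commute[of p s] by (auto simp: crossing_quadruple_def)
  then show "diam {p, q, r, s} d \<le> ereal D"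
    unfolding diam_def by (intro SUP_least) (auto split: prod.splits)
  show "ereal D \<le> diam {p, q, r, s} d"
    using dist_le_diam[of p "{p, q, r, s}" q] assms(1) by (simp add: crossing_quadruple_def)
qed

text \<open>Edges of the cycle correspond to sides, whose length is the diameter; the two non-edges
  correspond to diagonals, which are strictly shorter since no distance exceeds the
  diameter.\<close>

lemma diametrical_C4_iff:
  "(\<exists>S. S \<subseteq> M \<and> card S = 4 \<and> graph_isomorphic S (diametrical_edges S d) C4_verts C4_edges) \<longleftrightarrow>
   (\<exists>p q r s D. {p, q, r, s} \<subseteq> M \<and> crossing_quadruple d p q r s D)" (is "?L \<longleftrightarrow> ?R")
proof
  assume ?L
  then obtain S f where S: "S \<subseteq> M" and f: "bij_betw f S {1, 2, 3, 4}"
    and e: "\<And>u v. u \<in> S \<Longrightarrow> v \<in> S \<Longrightarrow> {u, v} \<in> diametrical_edges S d \<longleftrightarrow> {f u, f v} \<in> C4_edges"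
    unfolding graph_isomorphic_def C4_verts_def by blast
  obtain p q r s where pqrs: "S = {p, q, r, s}" and fv: "f p = 1" "f q = 2" "f r = 3" "f s = 4"
    using bij_betw_onto_four[OF f] .
  have "p \<noteq> r" "q \<noteq> s" using fv by auto
  moreover have in_edges: "ereal (d p q) = diam S d" "ereal (d q r) = diam S d"
      "ereal (d r s) = diam S d" "ereal (d s p) = diam S d"
    using e[of p q] e[of q r] e[of r s] e[of s p] fv pqrs
    by (auto simp: diametrical_edge_iff C4_edges_def)
  moreover have "ereal (d p r) \<noteq> diam S d" "ereal (d q s) \<noteq> diam S d"
    using e[of p r] e[of q s] fv pqrs \<open>p \<noteq> r\<close> \<open>q \<noteq> s\<close>
    by (auto simp: diametrical_edge_iff C4_edges_def doubleton_eq_iff)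
  then have "ereal (d p r) < ereal (d p q)" "ereal (d q s) < ereal (d p q)"
    using dist_le_diam[of p S r] dist_le_diam[of q S s] pqrs in_edges(1) by auto
  ultimately have "crossing_quadruple d p q r s (d p q)"
    unfolding crossing_quadruple_def by (metis ereal.inject ereal_less_eq(3) less_le_not_le)
  then show ?R using S pqrs by blast
next
  assume ?R
  then obtain p q r s D where M: "{p, q, r, s} \<subseteq> M" and cr: "crossing_quadruple d p q r s D" by blast
  let ?S = "{p, q, r, s}"
  have dist: "distinct [p, q, r, s]" using crossing_quadruple_distinct[OF cr M] .
  obtain f where f: "bij_betw f ?S {1, 2, 3, 4 :: nat}"
    and fv: "f p = 1" "f q = 2" "f r = 3" "f s = 4"
    using bij_betw_four_onto[OF dist] .
  have ne: "p \<noteq> q" "p \<noteq> r" "p \<noteq> s" "q \<noteq> r" "q \<noteq> s" "r \<noteq> s"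
    using dist by auto
  have ds: "d p q = D" "d q p = D" "d q r = D" "d r q = D" "d r s = D" "d s r = D" "d s p = D"
      "d p s = D" "d p r \<noteq> D" "d r p \<noteq> D" "d q s \<noteq> D" "d s q \<noteq> D"
    using cr commute[of r p] commute[of s q] commute[of q p] commute[of r q]
      commute[of s r] commute[of p s] by (auto simp: crossing_quadruple_def)
  have "{u, v} \<in> diametrical_edges ?S d \<longleftrightarrow> {f u, f v} \<in> C4_edges" if "u \<in> ?S" "v \<in> ?S" for u v
    using that unfolding diametrical_edge_iff crossing_quadruple_diam[OF cr M]
    by (elim insertE emptyE)
      (simp_all add: fv ds ne ne[symmetric] C4_edges_def doubleton_eq_iff)
  then have "graph_isomorphic ?S (diametrical_edges ?S d) C4_verts C4_edges"
    unfolding graph_isomorphic_def C4_verts_def using f by blast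
  moreover have "card ?S = 4" using dist by simp
  ultimately show ?L using M by blast
qed

section \<open>Weak similarity to \<open>X4\<close> or \<open>Y4\<close>\<close>

lemma weakly_similar_imp_crossing_quadruple:
  assumes "weakly_similar S d {1, 2, 3, 4 :: nat} \<delta>"
    and \<delta>: "crossing_quadruple \<delta> 1 2 3 4 K"
  obtains p q r s D where "S = {p, q, r, s}" "crossing_quadruple d p q r s D"
proof -
  let ?N = "{1, 2, 3, 4 :: nat}"
  obtain \<Phi> f where \<Phi>: "bij_betw \<Phi> S ?N" and f: "strict_mono_on (dist_set ?N \<delta>) f"
    and df: "\<And>x y. x \<in> S \<Longrightarrow> y \<in> S \<Longrightarrow> d x y = f (\<delta> (\<Phi> x) (\<Phi> y))"
    using assms(1) unfolding weakly_similar_def by blast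
  obtain p q r s where pqrs: "S = {p, q, r, s}" and v: "\<Phi> p = 1" "\<Phi> q = 2" "\<Phi> r = 3" "\<Phi> s = 4"
    using bij_betw_onto_four[OF \<Phi>] .
  have mem: "\<delta> i j \<in> dist_set ?N \<delta>" if "i \<in> ?N" "j \<in> ?N" for i j
    using that unfolding dist_set_def by blast
  \<comment> \<open>Being strictly increasing, \<open>f\<close> keeps the diagonals shorter than the
    sides, whose common length becomes \<open>f K\<close>.\<close>
  have "f (\<delta> 1 3) < f (\<delta> 1 2)" "f (\<delta> 2 4) < f (\<delta> 1 2)"
    using strict_mono_onD[OF f mem mem, of 1 3 1 2] strict_mono_onD[OF f mem mem, of 2 4 1 2] \<delta>
    by (auto simp: crossing_quadruple_def)
  then have "crossing_quadruple d p q r s (f K)"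
    using df pqrs v \<delta> by (auto simp: crossing_quadruple_def)
  with pqrs show thesis using that by blast
qed

text \<open>Equal diagonals give \<open>Y4\<close>, unequal ones \<open>X4\<close>. The hypothesis
  \<open>le\<close> matches \<open>d p r\<close> with \<open>d4 1 3 = 1\<close>, the shorter
  diagonal of \<open>X4\<close>.\<close>

lemma crossing_quadruple_imp_weakly_similar:
  assumes cr: "crossing_quadruple d p q r s D" and M: "{p, q, r, s} \<subseteq> M"
    and le: "d p r \<le> d q s"
  shows "weakly_similar {p, q, r, s} d X4 d4 \<or> weakly_similar {p, q, r, s} d Y4 rho4"
proof -
  let ?S = "{p, q, r, s}"
  have dist: "distinct [p, q, r, s]" using crossing_quadruple_distinct[OF cr M] .
  obtain \<Phi> where \<Phi>: "bij_betw \<Phi> ?S {1, 2, 3, 4 :: nat}"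
    and v: "\<Phi> p = 1" "\<Phi> q = 2" "\<Phi> r = 3" "\<Phi> s = 4"
    using bij_betw_four_onto[OF dist] .
  have pos: "0 < d p r" using mdist_pos_less[of p r] dist M by auto
  \<comment> \<open>One scale function serves both models: the diagonal lengths 1 and 2 go to
    \<open>d p r\<close> and \<open>d q s\<close>, the side length 3 to \<open>D\<close>.\<close>
  define f where "f t = (if t = 0 then 0 else if t = 1 then d p r else if t = 2 then d q s else D)"
    for t :: real
  have lt: "d q s < D" "d p r < D" using cr by (auto simp: crossing_quadruple_def)
  show ?thesis
  proof (cases "d p r = d q s")
    case True
    \<comment> \<open>Here \<open>f 1 = f 2\<close>, so strict monotonicity depends on 1 not being a
      distance of \<open>rho4\<close>.\<close>
    have ds: "dist_set {1, 2, 3, 4} rho4 \<subseteq> {0, 2, 3}" by (auto simp: dist_set_def rho4_def)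
    have "strict_mono_on (dist_set {1, 2, 3, 4} rho4) f"
      using pos lt True
      by (intro monotone_on_subset[OF _ ds] strict_mono_onI) (auto simp: f_def)
    moreover have "d x y = f (rho4 (\<Phi> x) (\<Phi> y))" if "x \<in> ?S" "y \<in> ?S" for x y
      using that cr M True v commute[of r p] commute[of s q] commute[of q p] commute[of r q]
        commute[of s r] commute[of p s]
      by (elim insertE emptyE)
        (simp_all add: crossing_quadruple_def f_def rho4_def doubleton_eq_iff)
    ultimately show ?thesis
      using weakly_similarI[OF \<Phi>] unfolding Y4_def by blast
  next
    case False
    have ds: "dist_set {1, 2, 3, 4} d4 \<subseteq> {0, 1, 2, 3}" by (auto simp: dist_set_def d4_def)
    have "strict_mono_on (dist_set {1, 2, 3, 4} d4) f"
      using pos lt le False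
      by (intro monotone_on_subset[OF _ ds] strict_mono_onI) (auto simp: f_def)
    moreover have "d x y = f (d4 (\<Phi> x) (\<Phi> y))" if "x \<in> ?S" "y \<in> ?S" for x y
      using that cr M v commute[of r p] commute[of s q] commute[of q p] commute[of r q]
        commute[of s r] commute[of p s]
      by (elim insertE emptyE)
        (simp_all add: crossing_quadruple_def f_def d4_def doubleton_eq_iff)
    ultimately show ?thesis
      using weakly_similarI[OF \<Phi>] unfolding X4_def by blast
  qed
qed

lemma weakly_similar_X4_Y4_iff:
  "(\<exists>S. S \<subseteq> M \<and> card S = 4 \<and> (weakly_similar S d X4 d4 \<or> weakly_similar S d Y4 rho4)) \<longleftrightarrow>
   (\<exists>p q r s D. {p, q, r, s} \<subseteq> M \<and> crossing_quadruple d p q r s D)" (is "?L \<longleftrightarrow> ?R")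
proof
  assume ?L
  then obtain S where S: "S \<subseteq> M" and "weakly_similar S d X4 d4 \<or> weakly_similar S d Y4 rho4"
    by blast
  \<comment> \<open>Both model spaces are crossing quadruples themselves.\<close>
  moreover have "crossing_quadruple d4 1 2 3 4 3" "crossing_quadruple rho4 1 2 3 4 3"
    by (simp_all add: crossing_quadruple_def d4_def rho4_def doubleton_eq_iff)
  ultimately obtain p q r s D where "S = {p, q, r, s}" "crossing_quadruple d p q r s D"
    unfolding X4_def Y4_def by (metis weakly_similar_imp_crossing_quadruple)
  with S show ?R by blast
next
  assume ?R
  then obtain p q r s D where M: "{p, q, r, s} \<subseteq> M" and cr: "crossing_quadruple d p q r s D" by blast
  have "card {p, q, r, s} = 4" using crossing_quadruple_distinct[OF cr M] by simp
  moreover have "weakly_similar {p, q, r, s} d X4 d4 \<or> weakly_similar {p, q, r, s} d Y4 rho4"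
  proof (cases "d p r \<le> d q s")
    case True
    then show ?thesis using crossing_quadruple_imp_weakly_similar[OF cr M] by blast
  next
    case False
    have "{q, p, s, r} = {p, q, r, s}" by auto
    then show ?thesis
      using crossing_quadruple_imp_weakly_similar[OF crossing_quadruple_swap[OF cr]] M False by simp
  qed
  ultimately show ?L using M by blast
qed

section \<open>Embedding into labeled stars\<close>

lemma isometric_to_subspace_of_US_no_crossing_quadruple:
  assumes "isometric_to_subspace_of_US TYPE('c) M d" and M: "{p, q, r, s} \<subseteq> M"
  shows "\<not> crossing_quadruple d p q r s D"
proof
  assume cr: "crossing_quadruple d p q r s D"
  obtain Y \<rho> Z f where Y: "in_US (Y :: 'c set) \<rho>" and Z: "Z \<subseteq> Y" and f: "bij_betw f M Z"
    and iso: "\<And>x y. x \<in> M \<Longrightarrow> y \<in> M \<Longrightarrow> \<rho> (f x) (f y) = d x y"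
    using assms(1) unfolding isometric_to_subspace_of_US_def isometric_def by blast
  have inj: "f x = f y \<longleftrightarrow> x = y" if "x \<in> M" "y \<in> M" for x y
    using f that by (auto simp: bij_betw_def inj_on_def)
  have mem: "f x \<in> Y" if "x \<in> M" for x
    using f Z that by (auto simp: bij_betw_def)
  obtain m where m: "\<And>u v. u \<in> Y \<Longrightarrow> v \<in> Y \<Longrightarrow> u \<noteq> v \<Longrightarrow> \<rho> u v = max (m u) (m v)"
    using in_US_imp_max_form[OF Y] by blast
  have "crossing_quadruple \<rho> (f p) (f q) (f r) (f s) D"
    using cr iso inj M by (auto simp: crossing_quadruple_def)
  moreover have "f p \<noteq> f q"
    using crossing_quadruple_distinct[OF cr M] inj M by auto
  ultimately show False
    using no_crossing_quadruple_in_max_form[where Y = Y and \<rho> = \<rho> and m = m] m mem M by simp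
qed

text \<open>The infimum need not be attained. For \<open>x\<close> in an infinite \<open>M\<close>
  it vanishes exactly when \<open>x\<close> is not isolated.\<close>

definition nearest_dist :: "'a \<Rightarrow> real" where
  "nearest_dist x = (INF y \<in> M - {x}. d x y)"

lemma nearest_dist_le:
  assumes "y \<in> M" "x \<noteq> y"
  shows "nearest_dist x \<le> d x y"
  unfolding nearest_dist_def
  by (rule cINF_lower) (use assms in \<open>auto intro!: bdd_belowI[of _ 0]\<close>)

lemma nearest_dist_nonneg:
  assumes "infinite M"
  shows "0 \<le> nearest_dist x"
proof -
  have "M - {x} \<noteq> {}" using assms by (metis finite.emptyI finite_Diff_insert Diff_empty)
  then show ?thesis unfolding nearest_dist_def by (intro cINF_greatest) auto
qed

lemma nearest_dist_lessE:
  assumes "y \<in> M" "x \<noteq> y" "nearest_dist x < D"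
  obtains z where "z \<in> M" "z \<noteq> x" "d x z < D"
proof -
  have "bdd_below (d x ` (M - {x}))" by (rule bdd_belowI[of _ 0]) auto
  moreover have "M - {x} \<noteq> {}" using assms by auto
  ultimately show thesis
    using cINF_less_iff[of "M - {x}" "d x" D] assms(3) that unfolding nearest_dist_def by blast
qed

text \<open>Of the three sides of an ultrametric triangle the two longest agree; each inequality is
  one instance of \<open>ultra\<close>.\<close>

lemma isosceles:
  assumes "x \<in> M" "y \<in> M" "z \<in> M" "d x z < d x y"
  shows "d z y = d x y"
  using ultra[of x y z] ultra[of z y x] commute[of x z] assms by auto

lemma dist_eq_max_nearest_dist:
  assumes no: "\<And>p q r s D. {p, q, r, s} \<subseteq> M \<Longrightarrow> \<not> crossing_quadruple d p q r s D"
    and xy: "x \<in> M" "y \<in> M" "x \<noteq> y"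
  shows "d x y = max (nearest_dist x) (nearest_dist y)"
proof (rule ccontr)
  assume "d x y \<noteq> max (nearest_dist x) (nearest_dist y)"
  \<comment> \<open>Both infima are at most \<open>d x y\<close>, so the equation can fail only if
    both are strictly smaller.\<close>
  then have lt: "nearest_dist x < d x y" "nearest_dist y < d x y"
    using nearest_dist_le[of y x] nearest_dist_le[of x y] xy commute[of x y] by auto
  obtain x' where x': "x' \<in> M" "x' \<noteq> x" "d x x' < d x y"
    using nearest_dist_lessE[OF xy(2,3) lt(1)] .
  obtain y' where y': "y' \<in> M" "y' \<noteq> y" "d y y' < d x y"
    using nearest_dist_lessE[OF xy(1) _ lt(2)] xy(3) by blast
  \<comment> \<open>Moving \<open>x\<close> to \<open>x'\<close> and \<open>y\<close> to
    \<open>y'\<close> by less than \<open>d x y\<close> changes none of the cross distances.\<close>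
  have a: "d x' y = d x y" using isosceles[of x y x'] x' xy by blast
  have b: "d y' x = d x y" using isosceles[of y x y'] y' xy commute[of x y] by simp
  have c: "d y' x' = d x y" using isosceles[of y x' y'] y' x' xy a commute[of x' y] by simp
  have "crossing_quadruple d x y x' y' (d x y)"
    using x' y' a b c commute[of x' y] commute[of y' x'] by (auto simp: crossing_quadruple_def)
  then show False using no[of x y x' y'] xy x' y' by blast
qed

lemma no_crossing_quadruple_isometric_to_subspace_of_US:
  assumes inf: "infinite M"
    and no: "\<And>p q r s D. {p, q, r, s} \<subseteq> M \<Longrightarrow> \<not> crossing_quadruple d p q r s D"
  shows "isometric_to_subspace_of_US TYPE('a) M d"
proof (cases "\<exists>c\<in>M. nearest_dist c = 0")
  case True
  then obtain c where "c \<in> M" "nearest_dist c = 0" by blast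
  then have "in_US M d"
    using max_form_imp_in_US[OF Ultrametric_space_axioms, of c nearest_dist]
      nearest_dist_nonneg[OF inf] dist_eq_max_nearest_dist[OF no] by blast
  moreover have "isometric M d M d"
    unfolding isometric_def by (rule exI[of _ id]) auto
  ultimately show ?thesis
    unfolding isometric_to_subspace_of_US_def by blast
next
  case False
  obtain c where c: "c \<in> M" using inf by (metis finite.emptyI ex_in_conv)
  obtain h where h: "bij_betw h M (M - {c})"
    using infinite_imp_bij_betw[OF inf] by blast
  \<comment> \<open>\<open>h\<close> frees the point \<open>c\<close>, which becomes the new center.\<close>
  define m where "m u = (if u = c then 0 else nearest_dist (inv_into M h u))" for u
  define \<rho> where "\<rho> u v = (if u = v then 0 else max 0 (max (m u) (m v)))" for u v
  have mh: "m (h x) = nearest_dist x" if "x \<in> M" for x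
    using h that bij_betw_inv_into_left[OF h that] by (auto simp: m_def bij_betw_def)
  have inv: "inv_into M h u \<in> M" if "u \<in> M" "u \<noteq> c" for u
    using bij_betw_apply[OF bij_betw_inv_into[OF h]] that by blast
  have m0: "0 \<le> m u" for u using nearest_dist_nonneg[OF inf] by (simp add: m_def)
  \<comment> \<open>In this case \<open>nearest_dist\<close> has no zero on \<open>M\<close>, so the
    new center is the only zero of \<open>m\<close> there; this keeps \<open>\<rho>\<close> positive
    on distinct points.\<close>
  have mpos: "m u = 0 \<longleftrightarrow> u = c" if "u \<in> M" for u
    using False inv[OF that] by (auto simp: m_def)
  have "Ultrametric_space M \<rho>"
    unfolding \<rho>_def using m0 mpos by (intro Ultrametric_space_max_form) auto
  then have "in_US M \<rho>"
    by (rule max_form_imp_in_US[where m = m and c = c])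
      (use c m0 mpos[OF c] in \<open>auto simp: \<rho>_def max_def intro: antisym\<close>)
  moreover have "\<rho> (h x) (h y) = d x y" if xy: "x \<in> M" "y \<in> M" for x y
  proof (cases "x = y")
    case False
    then have "h x \<noteq> h y" using h xy by (auto simp: bij_betw_def inj_on_def)
    then show ?thesis
      using dist_eq_max_nearest_dist[OF no xy False] nearest_dist_nonneg[OF inf, of x]
      by (simp add: \<rho>_def mh xy)
  qed (use xy in \<open>simp add: \<rho>_def\<close>)
  then have "isometric M d (M - {c}) \<rho>"
    unfolding isometric_def using h by blast
  ultimately show ?thesis
    unfolding isometric_to_subspace_of_US_def by blast
qed

end

theorem theorem5p6:
  fixes X :: "'a set" and d :: "'a \<Rightarrow> 'a \<Rightarrow> real"
  assumes "Ultrametric_space X d" and "infinite X"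
  shows "(isometric_to_subspace_of_US TYPE('a) X d \<longleftrightarrow>
            \<not> (\<exists>S. S \<subseteq> X \<and> card S = 4 \<and>
                 graph_isomorphic S (diametrical_edges S d) C4_verts C4_edges))
       \<and> (\<not> (\<exists>S. S \<subseteq> X \<and> card S = 4 \<and>
                 graph_isomorphic S (diametrical_edges S d) C4_verts C4_edges) \<longleftrightarrow>
            \<not> (\<exists>S. S \<subseteq> X \<and> card S = 4 \<and>
                 (weakly_similar S d X4 d4 \<or> weakly_similar S d Y4 rho4)))
       \<and> (isometric_to_subspace_of_US TYPE('b) X d \<longrightarrow> isometric_to_subspace_of_US TYPE('a) X d)"
proof -
  interpret Ultrametric_space X d by fact
  let ?crossing = "\<exists>p q r s D. {p, q, r, s} \<subseteq> X \<and> crossing_quadruple d p q r s D"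
  have "isometric_to_subspace_of_US TYPE('a) X d \<Longrightarrow> \<not> ?crossing"
    using isometric_to_subspace_of_US_no_crossing_quadruple by blast
  \<comment> \<open>An embedding into a star over any type excludes crossings, and their absence
    already gives an embedding over \<open>'a\<close>; hence the last conjunct.\<close>
  moreover have "isometric_to_subspace_of_US TYPE('b) X d \<Longrightarrow> \<not> ?crossing"
    using isometric_to_subspace_of_US_no_crossing_quadruple by blast
  moreover have "\<not> ?crossing \<Longrightarrow> isometric_to_subspace_of_US TYPE('a) X d"
    by (rule no_crossing_quadruple_isometric_to_subspace_of_US[OF assms(2)]) blast
  ultimately show ?thesis
    unfolding diametrical_C4_iff weakly_similar_X4_Y4_iff by argo
qed

end
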